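(* Let $a>0$, $\tfrac12<\alpha<1$. Let $u_0:\mathbb{R}\to\mathbb{R}$ be a non-random, non-negative, bounded function, not depending on $\lambda$, for which there is a constant $c>0$ with $u_0(x)>c$ for all $x\in\mathbb{R}$. Let $\sigma:\mathbb{R}\to\mathbb{R}$ satisfy $\sigma(0)=0$, and suppose there are finite positive constants $L_\sigma,\mathrm{Lip}_\sigma$ such that $|\sigma(x)-\sigma(y)|\le \mathrm{Lip}_\sigma|x-y|$ and $|\sigma(x)|\ge L_\sigma|x|$ for all $x,y\in\mathbb{R}$. For each $\lambda>0$ let $u=u_\lambda$ be an $L^2$-continuous solution of $$T^a_{\alpha,t}u(x,t)=\lambda\,\sigma(u(x,t))\,\dot W_t,\qquad x\in\mathbb{R},\ t>a,$$ with initial condition $u_0$. Then for all $x\in\mathbb{R}$ and $t>a$, $$\frac{L_\sigma^2(t-a)^{2\alpha-1}}{2\alpha-1}\le\liminf_{\lambda\to\infty}\frac{\log\mathbb{E}|u(x,t)|^2}{\lambda^2}\le\limsup_{\lambda\to\infty}\frac{\log\mathbb{E}|u(x,t)|^2}{\lambda^2}\le\frac{\mathrm{Lip}_\sigma^2(t-a)^{2\alpha-1}}{2\alpha-1}.$$ When $\mathrm{Lip}_\sigma=L_\sigma=L$, for all $x\in\mathbb{R}$ and $t>a$, $$\limsup_{\lambda\to\infty}\frac{\log\mathbb{E}|u(x,t)|^2}{\lambda^2}=\frac{L^2(t-a)^{2\alpha-1}}{2\alpha-1}.$$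
   Context: $(W_t)_{t\ge 0}$ is a standard one-dimensional Wiener process with its filtration and $\dot W_t$ its generalized derivative; $T^a_{\alpha,t}v(x,t)=\lim_{\epsilon\to0}\frac{v(x,t+\epsilon(t-a)^{1-\alpha})-v(x,t)}{\epsilon}$ is the conformable time-fractional derivative of order $\alpha$ starting from $a$. A solution of the equation is understood in the mild sense: a random field $u=(u(x,t))_{x\in\mathbb{R},t\ge a}$ such that for each $x$ the process $t\mapsto u(x,t)$ is predictable, $\int_a^t(s-a)^{2(\alpha-1)}\mathbb{E}|\sigma(u(x,s))|^2\,ds<\infty$ for all $t\geq a$, and, almost surely for each $x\in\mathbb{R}$ and $t\ge a$, $$u(x,t)=u_0(x)+\lambda\int_a^t(s-a)^{\alpha-1}\sigma(u(x,s))\,dW_s\quad\text{(It\^o integral)}.$$ $u$ is $L^2$-continuous if $\mathbb{E}|u(x,t)|^2<\infty$ for all $(x,t)$ and $(x,t)\mapsto u(x,t)\in L^2(\mathbb{P})$ is continuous. *)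

theory Defs
  imports "HOL-Probability.Probability"
begin

text \<open>A standard Wiener process relative to a filtration. Only the times \<open>t \<ge> 0\<close> matter: for
  \<open>t < 0\<close> the \<sigma>-algebra \<open>F t\<close> can be taken trivial. Both the natural filtration of \<open>W\<close> and its
  augmentation by null sets are instances.\<close>

locale wiener_process = prob_space M + filtration "space M" F
  for M :: "'a measure" and F :: "real \<Rightarrow> 'a measure" +
  fixes W :: "real \<Rightarrow> 'a \<Rightarrow> real"
  assumes sets_F_subset: "0 \<le> t \<Longrightarrow> sets (F t) \<subseteq> sets M"
    and adapted: "0 \<le> t \<Longrightarrow> W t \<in> borel_measurable (F t)"
    and starts_at_0: "AE \<omega> in M. W 0 \<omega> = 0"
    and continuous_paths: "AE \<omega> in M. continuous_on {0..} (\<lambda>t. W t \<omega>)"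
    and normal_increments: "0 \<le> s \<Longrightarrow> s < t \<Longrightarrow>
      distributed M lborel (\<lambda>\<omega>. W t \<omega> - W s \<omega>) (normal_density 0 (sqrt (t - s)))"
    and independent_increments: "0 \<le> s \<Longrightarrow> s < t \<Longrightarrow>
      indep_set (sets (F s)) (sets (vimage_algebra (space M) (\<lambda>\<omega>. W t \<omega> - W s \<omega>) borel))"

text \<open>The predictable \<sigma>-algebra on \<open>[a, \<infinity>) \<times> \<Omega>\<close>.\<close>

definition predictable_sigma :: "real \<Rightarrow> (real \<Rightarrow> 'a measure) \<Rightarrow> 'a measure \<Rightarrow> (real \<times> 'a) measure"
  where "predictable_sigma a F M = sigma ({a..} \<times> space M)
    ({{a} \<times> A | A. A \<in> sets (F a)} \<union> {{s<..t} \<times> A | s t A. a \<le> s \<and> s < t \<and> A \<in> sets (F s)})"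

definition predictable :: "real \<Rightarrow> (real \<Rightarrow> 'a measure) \<Rightarrow> 'a measure \<Rightarrow> (real \<Rightarrow> 'a \<Rightarrow> real) \<Rightarrow> bool"
  where "predictable a F M H \<longleftrightarrow> (\<lambda>(s, \<omega>). H s \<omega>) \<in> borel_measurable (predictable_sigma a F M)"

text \<open>An elementary process on \<open>[a, t]\<close> is given by a partition \<open>a = \<tau> 0 \<le> \<dots> \<le> \<tau> n = t\<close> and by bounded
  random weights \<open>\<xi> i\<close>, known at time \<open>\<tau> i\<close>, on the intervals \<open>(\<tau> i, \<tau> (i + 1)]\<close>.\<close>

definition elementary_data :: "real \<Rightarrow> real \<Rightarrow> (real \<Rightarrow> 'a measure) \<Rightarrow> 'a measure \<Rightarrow>
    nat \<Rightarrow> (nat \<Rightarrow> real) \<Rightarrow> (nat \<Rightarrow> 'a \<Rightarrow> real) \<Rightarrow> bool"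
  where "elementary_data a t F M n \<tau> \<xi> \<longleftrightarrow> \<tau> 0 = a \<and> \<tau> n = t \<and>
    (\<forall>i<n. \<tau> i \<le> \<tau> (Suc i) \<and> \<xi> i \<in> borel_measurable (F (\<tau> i)) \<and>
      (\<exists>B. \<forall>\<omega>\<in>space M. \<bar>\<xi> i \<omega>\<bar> \<le> B))"

definition elementary_process ::
    "nat \<Rightarrow> (nat \<Rightarrow> real) \<Rightarrow> (nat \<Rightarrow> 'a \<Rightarrow> real) \<Rightarrow> real \<Rightarrow> 'a \<Rightarrow> real"
  where "elementary_process n \<tau> \<xi> s \<omega> = (\<Sum>i<n. \<xi> i \<omega> * indicator {\<tau> i<..\<tau> (Suc i)} s)"

definition elementary_integral :: "(real \<Rightarrow> 'a \<Rightarrow> real) \<Rightarrow>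
    nat \<Rightarrow> (nat \<Rightarrow> real) \<Rightarrow> (nat \<Rightarrow> 'a \<Rightarrow> real) \<Rightarrow> 'a \<Rightarrow> real"
  where "elementary_integral W n \<tau> \<xi> \<omega> = (\<Sum>i<n. \<xi> i \<omega> * (W (\<tau> (Suc i)) \<omega> - W (\<tau> i) \<omega>))"

text \<open>\<open>has_ito_integral M F W a t H I\<close> says that \<open>I\<close> is a version of \<open>\<integral>\<^sub>a\<^sup>t H\<^sub>s dW\<^sub>s\<close>: \<open>H\<close> is predictable and
  square integrable over \<open>[a, t] \<times> \<Omega>\<close>, and \<open>I\<close> is the \<open>L\<^sup>2\<close>-limit of the integrals of elementary
  processes that converge to \<open>H\<close> in \<open>L\<^sup>2([a, t] \<times> \<Omega>)\<close>. By the Ito isometry such an \<open>I\<close> exists and is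
  unique almost surely.\<close>

definition has_ito_integral :: "'a measure \<Rightarrow> (real \<Rightarrow> 'a measure) \<Rightarrow> (real \<Rightarrow> 'a \<Rightarrow> real) \<Rightarrow>
    real \<Rightarrow> real \<Rightarrow> (real \<Rightarrow> 'a \<Rightarrow> real) \<Rightarrow> ('a \<Rightarrow> real) \<Rightarrow> bool"
  where "has_ito_integral M F W a t H I \<longleftrightarrow>
    predictable a F M H \<and>
    (\<integral>\<^sup>+s\<in>{a..t}. (\<integral>\<^sup>+\<omega>. ennreal ((H s \<omega>)\<^sup>2) \<partial>M) \<partial>lborel) < \<infinity> \<and>
    I \<in> borel_measurable M \<and>
    (\<exists>n \<tau> \<xi>. (\<forall>k::nat. elementary_data a t F M (n k) (\<tau> k) (\<xi> k)) \<and>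
      (\<lambda>k. \<integral>\<^sup>+s\<in>{a..t}. (\<integral>\<^sup>+\<omega>. ennreal
          ((elementary_process (n k) (\<tau> k) (\<xi> k) s \<omega> - H s \<omega>)\<^sup>2) \<partial>M) \<partial>lborel) \<longlonglongrightarrow> 0 \<and>
      (\<lambda>k. \<integral>\<^sup>+\<omega>. ennreal
          ((elementary_integral W (n k) (\<tau> k) (\<xi> k) \<omega> - I \<omega>)\<^sup>2) \<partial>M) \<longlonglongrightarrow> 0)"

text \<open>Mild solutions of \<open>T\<^sup>a\<^bsub>\<alpha>,t\<^esub> u = l * \<sigma>(u) * dW/dt\<close> for \<open>t > a\<close>, with initial condition \<open>u0\<close>. The value
  \<open>0 powr (\<alpha> - 1) = 0\<close> at \<open>s = a\<close> is irrelevant to the integrals.\<close>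

definition mild_solution :: "'a measure \<Rightarrow> (real \<Rightarrow> 'a measure) \<Rightarrow> (real \<Rightarrow> 'a \<Rightarrow> real) \<Rightarrow>
    real \<Rightarrow> real \<Rightarrow> (real \<Rightarrow> real) \<Rightarrow> real \<Rightarrow> (real \<Rightarrow> real) \<Rightarrow> (real \<Rightarrow> real \<Rightarrow> 'a \<Rightarrow> real) \<Rightarrow> bool"
  where "mild_solution M F W a \<alpha> \<sigma> l u0 u \<longleftrightarrow>
    (\<forall>x. predictable a F M (u x)) \<and>
    (\<forall>x. \<forall>t\<ge>a. (\<integral>\<^sup>+s\<in>{a..t}. ennreal ((s - a) powr (2 * (\<alpha> - 1))) *
        (\<integral>\<^sup>+\<omega>. ennreal (\<bar>\<sigma> (u x s \<omega>)\<bar>\<^sup>2) \<partial>M) \<partial>lborel) < \<infinity>) \<and>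
    (\<forall>x. \<forall>t\<ge>a. \<exists>I. has_ito_integral M F W a t (\<lambda>s \<omega>. (s - a) powr (\<alpha> - 1) * \<sigma> (u x s \<omega>)) I \<and>
        (AE \<omega> in M. u x t \<omega> = u0 x + l * I \<omega>))"

definition L2_continuous :: "'a measure \<Rightarrow> real \<Rightarrow> (real \<Rightarrow> real \<Rightarrow> 'a \<Rightarrow> real) \<Rightarrow> bool"
  where "L2_continuous M a u \<longleftrightarrow>
    (\<forall>x. \<forall>t\<ge>a. u x t \<in> borel_measurable M \<and> integrable M (\<lambda>\<omega>. \<bar>u x t \<omega>\<bar>\<^sup>2)) \<and>
    (\<forall>x. \<forall>t\<ge>a. ((\<lambda>(y, s). sqrt (\<integral>\<omega>. \<bar>u y s \<omega> - u x t \<omega>\<bar>\<^sup>2 \<partial>M)) \<longlongrightarrow> 0)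
      (at (x, t) within UNIV \<times> {a..}))"

end

theory Submission
  imports Defs
begin

text \<open>
  The point \<open>x\<close> is only a parameter of the equation. Fix it and write \<open>g t = E (u x t)\<^sup>2\<close>. Since the initial
  value is deterministic, the Ito isometry turns the mild equation into
  \<open>g t = (u0 x)\<^sup>2 + l\<^sup>2 * \<integral>\<^sub>a\<^sup>t (s - a) powr (2 * \<alpha> - 2) * E (\<sigma> (u x s))\<^sup>2 ds\<close>
  (\<open>mild_solution_second_moment\<close>). Because \<open>\<sigma> 0 = 0\<close>, the Lipschitz bound gives \<open>\<bar>\<sigma> y\<bar> \<le> Lip * \<bar>y\<bar>\<close>, so the
  expectation under the integral lies between \<open>L\<^sup>2 * g s\<close> and \<open>Lip\<^sup>2 * g s\<close>.

  Thus \<open>g\<close> satisfies a linear integral inequality in each direction. The weight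
  \<open>(s - a) powr (2 * \<alpha> - 2)\<close> is singular at \<open>a\<close> but integrable, as \<open>\<alpha> > 1 / 2\<close>, with primitive
  \<open>A t = (t - a) powr (2 * \<alpha> - 1) / (2 * \<alpha> - 1)\<close>, and \<open>g\<close> is continuous by \<open>L\<^sup>2\<close>-continuity of the solution.
  Gronwall's argument in both directions (\<open>weighted_gronwall\<close>) yields
  \<open>(u0 x)\<^sup>2 * exp (l\<^sup>2 * L\<^sup>2 * A t) \<le> g t \<le> (u0 x)\<^sup>2 * exp (l\<^sup>2 * Lip\<^sup>2 * A t)\<close>
  (\<open>second_moment_bounds\<close>). After taking logarithms and dividing by \<open>l\<^sup>2\<close>, the initial value contributes
  \<open>ln ((u0 x)\<^sup>2) / l\<^sup>2\<close>, which vanishes as \<open>l\<close> grows because \<open>u0 x > 0\<close> does not depend on \<open>l\<close>.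

  The isometry itself (\<open>ito_isometry\<close>) is a statement about \<open>L\<^sup>2\<close>-limits: for elementary processes
  the independence of Wiener increments from the past removes all mixed terms, and squared norms are
  continuous under \<open>L\<^sup>2\<close>-convergence (\<open>tendsto_integral_square\<close>).
\<close>

section \<open>Convergence of squared norms\<close>

lemma integrable_mult_of_squares:
  fixes f g :: "'b \<Rightarrow> real"
  assumes [measurable]: "f \<in> borel_measurable N" "g \<in> borel_measurable N"
    and "integrable N (\<lambda>x. (f x)\<^sup>2)" "integrable N (\<lambda>x. (g x)\<^sup>2)"
  shows "integrable N (\<lambda>x. f x * g x)"
proof (rule Bochner_Integration.integrable_bound)
  show "integrable N (\<lambda>x. (f x)\<^sup>2 + (g x)\<^sup>2)"
    using assms by auto
  have "\<bar>u * v\<bar> \<le> u\<^sup>2 + v\<^sup>2" for u v :: real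
  proof -
    have "2 * (\<bar>u\<bar> * \<bar>v\<bar>) \<le> u\<^sup>2 + v\<^sup>2"
      using sum_squares_bound[of "\<bar>u\<bar>" "\<bar>v\<bar>"] by simp
    moreover have "0 \<le> \<bar>u\<bar> * \<bar>v\<bar>" by simp
    ultimately have "\<bar>u\<bar> * \<bar>v\<bar> \<le> u\<^sup>2 + v\<^sup>2" by linarith
    then show ?thesis by (simp add: abs_mult)
  qed
  then show "AE x in N. norm (f x * g x) \<le> norm ((f x)\<^sup>2 + (g x)\<^sup>2)"
    by simp
qed simp

lemma abs_integral_mult_le_sqrt:
  fixes f g :: "'b \<Rightarrow> real"
  assumes [measurable]: "f \<in> borel_measurable N" "g \<in> borel_measurable N"
    and f2: "integrable N (\<lambda>x. (f x)\<^sup>2)" and g2: "integrable N (\<lambda>x. (g x)\<^sup>2)"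
  shows "\<bar>\<integral>x. f x * g x \<partial>N\<bar> \<le> sqrt ((\<integral>x. (f x)\<^sup>2 \<partial>N) * (\<integral>x. (g x)\<^sup>2 \<partial>N))"
proof -
  have fg: "integrable N (\<lambda>x. f x * g x)"
    using assms by (rule integrable_mult_of_squares)
  have "(\<integral>\<^sup>+x. ennreal \<bar>f x\<bar> * ennreal \<bar>g x\<bar> \<partial>N)\<^sup>2
      \<le> (\<integral>\<^sup>+x. (ennreal \<bar>f x\<bar>)\<^sup>2 \<partial>N) * (\<integral>\<^sup>+x. (ennreal \<bar>g x\<bar>)\<^sup>2 \<partial>N)"
    by (rule Cauchy_Schwarz_nn_integral) simp_all
  also have "(\<integral>\<^sup>+x. ennreal \<bar>f x\<bar> * ennreal \<bar>g x\<bar> \<partial>N) = ennreal (\<integral>x. \<bar>f x * g x\<bar> \<partial>N)"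
    using integrable_abs[OF fg]
    by (subst nn_integral_eq_integral[symmetric]) (auto simp: ennreal_mult abs_mult)
  also have "(\<integral>\<^sup>+x. (ennreal \<bar>f x\<bar>)\<^sup>2 \<partial>N) = ennreal (\<integral>x. (f x)\<^sup>2 \<partial>N)"
    using f2 by (subst nn_integral_eq_integral[symmetric]) (auto simp: ennreal_power)
  also have "(\<integral>\<^sup>+x. (ennreal \<bar>g x\<bar>)\<^sup>2 \<partial>N) = ennreal (\<integral>x. (g x)\<^sup>2 \<partial>N)"
    using g2 by (subst nn_integral_eq_integral[symmetric]) (auto simp: ennreal_power)
  finally have "(\<integral>x. \<bar>f x * g x\<bar> \<partial>N)\<^sup>2 \<le> (\<integral>x. (f x)\<^sup>2 \<partial>N) * (\<integral>x. (g x)\<^sup>2 \<partial>N)"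
    by (simp add: ennreal_power ennreal_mult[symmetric])
  then have "(\<integral>x. \<bar>f x * g x\<bar> \<partial>N) \<le> sqrt ((\<integral>x. (f x)\<^sup>2 \<partial>N) * (\<integral>x. (g x)\<^sup>2 \<partial>N))"
    by (rule real_le_rsqrt)
  moreover have "\<bar>\<integral>x. f x * g x \<partial>N\<bar> \<le> (\<integral>x. \<bar>f x * g x\<bar> \<partial>N)"
    by (rule integral_abs_bound)
  ultimately show ?thesis by linarith
qed

lemma integrable_square_diff:
  fixes f g :: "'b \<Rightarrow> real"
  assumes "f \<in> borel_measurable N" "g \<in> borel_measurable N"
    and "integrable N (\<lambda>x. (f x)\<^sup>2)" "integrable N (\<lambda>x. (g x)\<^sup>2)"
  shows "integrable N (\<lambda>x. (f x - g x)\<^sup>2)"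
  using assms integrable_mult_of_squares[OF assms] by (simp add: power2_diff mult.assoc)

text \<open>The squared norm is continuous along \<open>L\<^sup>2\<close>-convergence:
  \<open>\<integral>f\<^sup>2 - \<integral>g\<^sup>2 = \<integral>(f - g)\<^sup>2 + 2 \<integral>g (f - g)\<close>, and Cauchy--Schwarz bounds the last term. A general filter
  is needed because the lemma serves both for the sequences that define an Ito integral and for the
  continuity of \<open>t \<mapsto> E (u x t)\<^sup>2\<close> in real time.\<close>

lemma tendsto_integral_square:
  fixes f :: "'c \<Rightarrow> 'b \<Rightarrow> real"
  assumes g: "g \<in> borel_measurable N" "integrable N (\<lambda>x. (g x)\<^sup>2)"
    and f: "\<forall>\<^sub>F k in G. f k \<in> borel_measurable N \<and> integrable N (\<lambda>x. (f k x)\<^sup>2)"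
    and lim: "((\<lambda>k. \<integral>\<^sup>+x. ennreal ((f k x - g x)\<^sup>2) \<partial>N) \<longlongrightarrow> 0) G"
  shows "((\<lambda>k. \<integral>x. (f k x)\<^sup>2 \<partial>N) \<longlongrightarrow> (\<integral>x. (g x)\<^sup>2 \<partial>N)) G"
proof -
  define d where "d k = (\<integral>x. (f k x - g x)\<^sup>2 \<partial>N)" for k
  define B where "B = (\<integral>x. (g x)\<^sup>2 \<partial>N)"
  have "\<forall>\<^sub>F k in G. (\<integral>\<^sup>+x. ennreal ((f k x - g x)\<^sup>2) \<partial>N) = ennreal (d k)"
    using f by eventually_elim
      (auto simp: d_def intro!: nn_integral_eq_integral integrable_square_diff g)
  with lim have "((\<lambda>k. ennreal (d k)) \<longlongrightarrow> ennreal 0) G"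
    by (auto elim!: Lim_transform_eventually)
  then have d0: "(d \<longlongrightarrow> 0) G"
    by (subst (asm) tendsto_ennreal_iff) (auto simp: d_def intro!: always_eventually)
  have "((\<lambda>k. d k + 2 * sqrt (B * d k)) \<longlongrightarrow> 0 + 2 * sqrt (B * 0)) G"
    by (intro tendsto_intros d0)
  then have bound0: "((\<lambda>k. d k + 2 * sqrt (B * d k)) \<longlongrightarrow> 0) G"
    by simp
  have "\<forall>\<^sub>F k in G. norm ((\<integral>x. (f k x)\<^sup>2 \<partial>N) - B) \<le> d k + 2 * sqrt (B * d k)"
    using f
  proof eventually_elim
    case (elim k)
    then have fk: "f k \<in> borel_measurable N" "integrable N (\<lambda>x. (f k x)\<^sup>2)"
      by auto
    have diff: "integrable N (\<lambda>x. (f k x - g x)\<^sup>2)"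
      by (intro integrable_square_diff fk g)
    have meas: "(\<lambda>x. f k x - g x) \<in> borel_measurable N"
      using fk g by simp
    have prod: "integrable N (\<lambda>x. g x * (f k x - g x))"
      by (intro integrable_mult_of_squares meas g diff)
    have "(\<integral>x. (f k x)\<^sup>2 \<partial>N)
        = (\<integral>x. (g x)\<^sup>2 + ((f k x - g x)\<^sup>2 + 2 * (g x * (f k x - g x))) \<partial>N)"
      by (intro Bochner_Integration.integral_cong) (auto simp: power2_eq_square algebra_simps)
    also have "\<dots> = B + (d k + 2 * (\<integral>x. g x * (f k x - g x) \<partial>N))"
      using g diff prod by (simp add: B_def d_def)
    finally have "(\<integral>x. (f k x)\<^sup>2 \<partial>N) - B = d k + 2 * (\<integral>x. g x * (f k x - g x) \<partial>N)"
      by simp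
    moreover have "\<bar>\<integral>x. g x * (f k x - g x) \<partial>N\<bar> \<le> sqrt (B * d k)"
      unfolding B_def d_def by (intro abs_integral_mult_le_sqrt meas g diff)
    moreover have "0 \<le> d k" by (simp add: d_def)
    ultimately show ?case by simp
  qed
  then have "((\<lambda>k. (\<integral>x. (f k x)\<^sup>2 \<partial>N) - B) \<longlongrightarrow> 0) G"
    using bound0 by (rule Lim_null_comparison)
  then show ?thesis
    unfolding B_def by (rule LIM_zero_cancel)
qed

text \<open>A single \<open>f k\<close> at finite distance from \<open>g\<close> is enough, because \<open>g = f k - (f k - g)\<close>.\<close>

lemma square_integrable_L2_limit:
  fixes f :: "'c \<Rightarrow> 'b \<Rightarrow> real"
  assumes "G \<noteq> bot" and g: "g \<in> borel_measurable N"
    and f: "\<And>k. f k \<in> borel_measurable N" "\<And>k. integrable N (\<lambda>x. (f k x)\<^sup>2)"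
    and lim: "((\<lambda>k. \<integral>\<^sup>+x. ennreal ((f k x - g x)\<^sup>2) \<partial>N) \<longlongrightarrow> 0) G"
  shows "integrable N (\<lambda>x. (g x)\<^sup>2)"
proof -
  have "\<forall>\<^sub>F k in G. (\<integral>\<^sup>+x. ennreal ((f k x - g x)\<^sup>2) \<partial>N) < 1"
    using lim by (rule order_tendstoD) simp
  then obtain k where k: "(\<integral>\<^sup>+x. ennreal ((f k x - g x)\<^sup>2) \<partial>N) < 1"
    using \<open>G \<noteq> bot\<close> by (auto dest: eventually_happens)
  have "(\<lambda>x. f k x - g x) \<in> borel_measurable N"
    using f g by simp
  moreover from this have "integrable N (\<lambda>x. (f k x - g x)\<^sup>2)"
    using k by (intro integrableI_bounded) (auto intro: order.strict_trans simp: top.not_eq_extremum)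
  ultimately have "integrable N (\<lambda>x. (f k x - (f k x - g x))\<^sup>2)"
    using f by (intro integrable_square_diff[of "f k" N "\<lambda>x. f k x - g x"])
  then show ?thesis by simp
qed

section \<open>Gronwall estimates with a singular weight\<close>

text \<open>The function \<open>P s * exp (- A s)\<close> has nonpositive derivative, so it decreases. Differentiability is
  required in the open interval only: below, \<open>A\<close> is a multiple of \<open>(s - a) powr (\<beta> + 1)\<close>, whose
  derivative may blow up at \<open>a\<close>.\<close>

lemma differential_gronwall_upper:
  fixes P A P' A' :: "real \<Rightarrow> real"
  assumes "a \<le> t" and contP: "continuous_on {a..t} P" and contA: "continuous_on {a..t} A"
    and derP: "\<And>s. a < s \<Longrightarrow> s < t \<Longrightarrow> (P has_real_derivative P' s) (at s)"
    and derA: "\<And>s. a < s \<Longrightarrow> s < t \<Longrightarrow> (A has_real_derivative A' s) (at s)"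
    and ineq: "\<And>s. a < s \<Longrightarrow> s < t \<Longrightarrow> P' s \<le> A' s * P s"
  shows "P t \<le> P a * exp (A t - A a)"
proof (cases "a = t")
  case False
  define Q where "Q s = P s * exp (- A s)" for s
  have derQ: "(Q has_real_derivative (P' s - A' s * P s) * exp (- A s)) (at s)"
    if "a < s" "s < t" for s
    unfolding Q_def using derP[OF that] derA[OF that]
    by (auto intro!: derivative_eq_intros simp: algebra_simps)
  have "\<exists>l z. a < z \<and> z < t \<and> DERIV Q z :> l \<and> Q t - Q a = (t - a) * l"
  proof (rule MVT)
    show "continuous_on {a..t} Q"
      unfolding Q_def by (intro continuous_intros contP contA)
    show "Q differentiable (at s)" if "a < s" "s < t" for s
      using derQ[OF that] by (auto simp: real_differentiable_def)
  qed (use False \<open>a \<le> t\<close> in simp)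
  then obtain l z where z: "a < z" "z < t" "DERIV Q z :> l" "Q t - Q a = (t - a) * l"
    by blast
  have "l = (P' z - A' z * P z) * exp (- A z)"
    using DERIV_unique derQ z by blast
  then have "l \<le> 0"
    using ineq[of z] z by (simp add: mult_nonpos_nonneg)
  then have "Q t \<le> Q a"
    using z \<open>a \<le> t\<close> by (smt (verit) mult_nonneg_nonpos)
  then have "Q t * exp (A t) \<le> Q a * exp (A t)"
    by simp
  then show ?thesis
    by (simp add: Q_def exp_minus exp_diff field_simps)
qed simp

lemma differential_gronwall_lower:
  fixes P A P' A' :: "real \<Rightarrow> real"
  assumes "a \<le> t" and "continuous_on {a..t} P" and "continuous_on {a..t} A"
    and "\<And>s. a < s \<Longrightarrow> s < t \<Longrightarrow> (P has_real_derivative P' s) (at s)"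
    and "\<And>s. a < s \<Longrightarrow> s < t \<Longrightarrow> (A has_real_derivative A' s) (at s)"
    and "\<And>s. a < s \<Longrightarrow> s < t \<Longrightarrow> A' s * P s \<le> P' s"
  shows "P a * exp (A t - A a) \<le> P t"
  using differential_gronwall_upper[of a t "\<lambda>s. - P s" A "\<lambda>s. - P' s" A'] assms
  by (simp add: continuous_on_minus DERIV_minus)

lemma has_integral_shifted_powr:
  fixes a t \<beta> :: real
  assumes "- 1 < \<beta>" "a \<le> t"
  shows "((\<lambda>s. (s - a) powr \<beta>) has_integral (t - a) powr (\<beta> + 1) / (\<beta> + 1)) {a..t}"
proof -
  have "((\<lambda>s. s powr \<beta>) has_integral (t - a) powr (\<beta> + 1) / (\<beta> + 1)) {0..t - a}"
    using assms by (intro has_integral_powr_from_0) auto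
  from has_integral_affinity'[OF this[unfolded box_real[symmetric]], of 1 "- a"] show ?thesis
    by (simp add: add.commute)
qed

text \<open>One primitive \<open>G\<close> of \<open>s \<mapsto> (s - a) powr \<beta> * g s\<close> serves both comparisons. If, say,
  \<open>g \<le> p + K * G\<close>, then \<open>P = p + K * G\<close> satisfies \<open>P' = K * (s - a) powr \<beta> * g \<le> A' * P\<close> with
  \<open>A = K * (s - a) powr (\<beta> + 1) / (\<beta> + 1)\<close>, and the differential Gronwall lemma applies to \<open>P\<close>; the
  reverse inequality is handled in the same way. The integral of \<open>k * (s - a) powr \<beta> * g s\<close> is given with
  a factor \<open>k\<close> and in extended nonnegative form because this is how it will be compared with the Ito
  isometry.\<close>

lemma weighted_gronwall:
  fixes a \<beta> :: real and g :: "real \<Rightarrow> real"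
  assumes \<beta>: "- 1 < \<beta>" and cont: "continuous_on {a..} g" and nonneg: "\<And>s. 0 \<le> g s"
  obtains G where
    "\<And>t k. \<lbrakk>a \<le> t; 0 \<le> k\<rbrakk> \<Longrightarrow>
      (\<integral>\<^sup>+s\<in>{a..t}. ennreal (k * ((s - a) powr \<beta> * g s)) \<partial>lborel) = ennreal (k * G t)"
    "\<And>t. a \<le> t \<Longrightarrow> 0 \<le> G t"
    "\<And>t p K. \<lbrakk>a \<le> t; 0 \<le> K; \<And>s. a \<le> s \<Longrightarrow> g s \<le> p + K * G s\<rbrakk>
      \<Longrightarrow> g t \<le> p * exp (K * ((t - a) powr (\<beta> + 1) / (\<beta> + 1)))"
    "\<And>t p K. \<lbrakk>a \<le> t; 0 \<le> K; \<And>s. a \<le> s \<Longrightarrow> p + K * G s \<le> g s\<rbrakk>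
      \<Longrightarrow> p * exp (K * ((t - a) powr (\<beta> + 1) / (\<beta> + 1))) \<le> g t"
proof -
  define w where "w s = (s - a) powr \<beta>" for s
  define A where "A t = (t - a) powr (\<beta> + 1) / (\<beta> + 1)" for t
  define G where "G t = integral {a..t} (\<lambda>s. w s * g s)" for t
  have w_int: "(w has_integral A t) {a..t}" if "a \<le> t" for t
    unfolding w_def A_def using \<beta> that by (rule has_integral_shifted_powr)
  have wg_int: "(\<lambda>s. w s * g s) integrable_on {a..t}" if "a \<le> t" for t
  proof -
    have "g absolutely_integrable_on {a..t}"
      by (rule absolutely_integrable_continuous_real)
        (rule continuous_on_subset[OF cont], simp)
    then have meas: "g \<in> borel_measurable (lebesgue_on {a..t})"
      by (intro integrable_imp_measurable absolutely_integrable_on_def[THEN iffD1, THEN conjunct1])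
    have bdd: "bounded (g ` {a..t})"
      by (intro compact_imp_bounded compact_continuous_image continuous_on_subset[OF cont]) auto
    have "w absolutely_integrable_on {a..t}"
      by (rule nonnegative_absolutely_integrable_1)
        (use w_int[OF that] in \<open>auto simp: w_def\<close>)
    then have "(\<lambda>s. g s * w s) absolutely_integrable_on {a..t}"
      by (intro absolutely_integrable_bounded_measurable_product_real meas bdd) auto
    then show ?thesis
      by (simp add: absolutely_integrable_on_def mult.commute)
  qed
  have contG: "continuous_on {a..t} G" if "a \<le> t" for t
    unfolding G_def by (rule indefinite_integral_continuous_1[OF wg_int[OF that]])
  have contA: "continuous_on {a..t} A" if "a \<le> t" for t
  proof -
    have "continuous_on {a..t} (\<lambda>s. integral {a..s} w)"
      using w_int[OF that] by (intro indefinite_integral_continuous_1) auto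
    then show ?thesis
      by (rule continuous_on_eq) (auto intro!: integral_unique w_int)
  qed
  have derA: "(A has_real_derivative w s) (at s)" if "a < s" for s
    unfolding A_def w_def using \<beta> that by (auto intro!: derivative_eq_intros)
  have derG: "(G has_real_derivative w s * g s) (at s)" if s: "a < s" for s
  proof -
    have "isCont g s"
      using cont s by (metis atLeast_iff continuous_on_interior interior_real_atLeast greaterThan_iff)
    then have "isCont (\<lambda>s. w s * g s) s"
      unfolding w_def using s by (intro continuous_intros) auto
    \<comment> \<open>Any right end point beyond \<open>s\<close> makes \<open>s\<close> an interior point; no exceptional set is removed.\<close>
    then have "continuous (at s within {a..s + 1} - {}) (\<lambda>s. w s * g s)"
      by (rule continuous_at_imp_continuous_at_within)
    then have "(G has_vector_derivative w s * g s) (at s within {a..s + 1} - {})"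
      unfolding G_def using s
      by (intro integral_has_vector_derivative_continuous_at wg_int) auto
    moreover have "at s within {a..s + 1} = at s"
      using s by (intro at_within_interior) auto
    ultimately show ?thesis
      by (simp add: has_real_derivative_iff_has_vector_derivative)
  qed
  show thesis
  proof
    show "(\<integral>\<^sup>+s\<in>{a..t}. ennreal (k * ((s - a) powr \<beta> * g s)) \<partial>lborel) = ennreal (k * G t)"
      if "a \<le> t" "0 \<le> k" for t k
      using nn_integral_has_integral_lebesgue'[OF _
          has_integral_mult_right[OF integrable_integral[OF wg_int[OF that(1)]], of k]] nonneg that(2)
      by (simp add: w_def G_def)
    show "0 \<le> G t" if "a \<le> t" for t
      unfolding G_def using nonneg by (intro integral_nonneg wg_int that) (auto simp: w_def)
    have G0: "G a = 0" "A a = 0" using \<beta> by (simp_all add: G_def A_def)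
    show "g t \<le> p * exp (K * ((t - a) powr (\<beta> + 1) / (\<beta> + 1)))"
      if t: "a \<le> t" and K: "0 \<le> K" and le: "\<And>s. a \<le> s \<Longrightarrow> g s \<le> p + K * G s" for t p K
    proof -
      have "p + K * G t \<le> (p + K * G a) * exp (K * A t - K * A a)"
      proof (rule differential_gronwall_upper[OF t])
        show "((\<lambda>s. p + K * G s) has_real_derivative K * (w s * g s)) (at s)" if "a < s" for s
          using derG[OF that] by (auto intro!: derivative_eq_intros)
        show "((\<lambda>s. K * A s) has_real_derivative K * w s) (at s)" if "a < s" for s
          using derA[OF that] by (auto intro!: derivative_eq_intros)
        show "K * (w s * g s) \<le> K * w s * (p + K * G s)" if "a < s" for s
          using le[of s] that K by (simp add: w_def mult.assoc mult_left_mono)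
      qed (intro continuous_intros contG contA t)+
      then show ?thesis
        using le[OF t] by (simp add: G0) (simp add: A_def)
    qed
    show "p * exp (K * ((t - a) powr (\<beta> + 1) / (\<beta> + 1))) \<le> g t"
      if t: "a \<le> t" and K: "0 \<le> K" and le: "\<And>s. a \<le> s \<Longrightarrow> p + K * G s \<le> g s" for t p K
    proof -
      have "(p + K * G a) * exp (K * A t - K * A a) \<le> p + K * G t"
      proof (rule differential_gronwall_lower[OF t])
        show "((\<lambda>s. p + K * G s) has_real_derivative K * (w s * g s)) (at s)" if "a < s" for s
          using derG[OF that] by (auto intro!: derivative_eq_intros)
        show "((\<lambda>s. K * A s) has_real_derivative K * w s) (at s)" if "a < s" for s
          using derA[OF that] by (auto intro!: derivative_eq_intros)
        show "K * w s * (p + K * G s) \<le> K * (w s * g s)" if "a < s" for s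
          using le[of s] that K by (simp add: w_def mult.assoc mult_left_mono)
      qed (intro continuous_intros contG contA t)+
      then show ?thesis
        using le[OF t] by (simp add: G0) (simp add: A_def)
    qed
  qed
qed

section \<open>Wiener increments\<close>

context wiener_process
begin

lemma measurable_F_imp_measurable: "0 \<le> t \<Longrightarrow> X \<in> borel_measurable (F t) \<Longrightarrow> X \<in> borel_measurable M"
  by (rule measurable_from_subalg[of M "F t"]) (simp_all add: subalgebra_def space_F sets_F_subset)

lemma measurable_F_mono:
  "s \<le> t \<Longrightarrow> X \<in> borel_measurable (F s) \<Longrightarrow> X \<in> borel_measurable (F t)"
  by (rule measurable_from_subalg[of "F t" "F s"]) (simp_all add: subalgebra_def space_F sets_F_mono)

lemma W_increment_measurable:
  assumes "0 \<le> s" "0 \<le> t"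
  shows "(\<lambda>\<omega>. W t \<omega> - W s \<omega>) \<in> borel_measurable M"
  using assms by (intro borel_measurable_diff adapted[THEN measurable_F_imp_measurable[rotated]])

lemma W_increment_moments:
  assumes "0 \<le> s" "s \<le> t"
  shows "integrable M (\<lambda>\<omega>. (W t \<omega> - W s \<omega>)\<^sup>2)"
    and "expectation (\<lambda>\<omega>. W t \<omega> - W s \<omega>) = 0"
    and "expectation (\<lambda>\<omega>. (W t \<omega> - W s \<omega>)\<^sup>2) = t - s"
proof -
  have "integrable M (\<lambda>\<omega>. (W t \<omega> - W s \<omega>)\<^sup>2) \<and> expectation (\<lambda>\<omega>. W t \<omega> - W s \<omega>) = 0 \<and>
    expectation (\<lambda>\<omega>. (W t \<omega> - W s \<omega>)\<^sup>2) = t - s"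
  proof (cases "s = t")
    case False
    then have pos: "0 < sqrt (t - s)"
      using assms by simp
    have D: "distributed M lborel (\<lambda>\<omega>. W t \<omega> - W s \<omega>) (normal_density 0 (sqrt (t - s)))"
      using assms False by (intro normal_increments) auto
    have mean: "expectation (\<lambda>\<omega>. W t \<omega> - W s \<omega>) = 0"
      using pos D by (rule normal_distributed_expectation)
    have "integrable M (\<lambda>\<omega>. (W t \<omega> - W s \<omega>)\<^sup>2)"
      using distributed_integrable[OF D, of "\<lambda>x. x\<^sup>2"] integrable_normal_moment[OF pos, of 0 2]
      by simp
    then show ?thesis
      using mean normal_distributed_variance[OF pos D] assms by simp
  qed simp
  then show "integrable M (\<lambda>\<omega>. (W t \<omega> - W s \<omega>)\<^sup>2)" "expectation (\<lambda>\<omega>. W t \<omega> - W s \<omega>) = 0"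
    "expectation (\<lambda>\<omega>. (W t \<omega> - W s \<omega>)\<^sup>2) = t - s"
    by blast+
qed

lemma indep_var_W_increment:
  assumes "0 \<le> s" "s < t" and X: "X \<in> borel_measurable (F s)"
  shows "indep_var borel X borel (\<lambda>\<omega>. W t \<omega> - W s \<omega>)"
  unfolding indep_var_eq
proof (intro conjI)
  show "X \<in> borel_measurable M"
    using assms by (intro measurable_F_imp_measurable[OF _ X])
  show "(\<lambda>\<omega>. W t \<omega> - W s \<omega>) \<in> borel_measurable M"
    using assms by (intro W_increment_measurable) auto
  have "{X -` A \<inter> space M |A. A \<in> sets borel} \<subseteq> sets (F s)"
    using measurable_sets[OF X] by (auto simp: space_F)
  then have "sigma_sets (space M) {X -` A \<inter> space M |A. A \<in> sets borel} \<subseteq> sets (F s)"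
    using sets.sigma_sets_subset[of _ "F s"] by (simp add: space_F)
  moreover have "indep_set (sets (F s))
      (sigma_sets (space M) {(\<lambda>\<omega>. W t \<omega> - W s \<omega>) -` A \<inter> space M |A. A \<in> sets borel})"
    using independent_increments[OF assms(1,2)] by (simp add: sets_vimage_algebra)
  ultimately show "indep_set (sigma_sets (space M) {X -` A \<inter> space M |A. A \<in> sets borel})
      (sigma_sets (space M) {(\<lambda>\<omega>. W t \<omega> - W s \<omega>) -` A \<inter> space M |A. A \<in> sets borel})"
    unfolding indep_set_def by (elim indep_sets_mono_sets) (auto split: bool.split)
qed

text \<open>The increment after time \<open>s\<close> is independent of everything known at time \<open>s\<close>, so expectations of
  products factor. The vanishing mean removes the mixed terms of a squared elementary integral, the second
  moment evaluates its diagonal terms.\<close>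

lemma expectation_mult_W_increment:
  assumes st: "0 \<le> s" "s \<le> t" and X: "X \<in> borel_measurable (F s)" "integrable M X"
  shows "integrable M (\<lambda>\<omega>. X \<omega> * (W t \<omega> - W s \<omega>))" (is ?int1)
    and "expectation (\<lambda>\<omega>. X \<omega> * (W t \<omega> - W s \<omega>)) = 0" (is ?mean)
    and "integrable M (\<lambda>\<omega>. X \<omega> * (W t \<omega> - W s \<omega>)\<^sup>2)" (is ?int2)
    and "expectation (\<lambda>\<omega>. X \<omega> * (W t \<omega> - W s \<omega>)\<^sup>2) = expectation X * (t - s)" (is ?var)
proof -
  have "?int1 \<and> ?mean \<and> ?int2 \<and> ?var"
  proof (cases "s = t")
    case False
    with st have indep: "indep_var borel X borel (\<lambda>\<omega>. W t \<omega> - W s \<omega>)"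
      by (intro indep_var_W_increment X) auto
    have "indep_var borel ((\<lambda>x. x) \<circ> X) borel ((\<lambda>x. x\<^sup>2) \<circ> (\<lambda>\<omega>. W t \<omega> - W s \<omega>))"
      by (rule indep_var_compose[OF indep]) simp_all
    then have indep2: "indep_var borel X borel (\<lambda>\<omega>. (W t \<omega> - W s \<omega>)\<^sup>2)"
      unfolding comp_def .
    have D: "integrable M (\<lambda>\<omega>. W t \<omega> - W s \<omega>)"
      using st W_increment_measurable W_increment_moments(1)
      by (auto intro!: square_integrable_imp_integrable[of "\<lambda>\<omega>. W t \<omega> - W s \<omega>"])
    show ?thesis
      using indep_var_integrable[OF indep X(2) D] indep_var_lebesgue_integral[OF indep X(2) D]
        indep_var_integrable[OF indep2 X(2)] indep_var_lebesgue_integral[OF indep2 X(2)]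
      by (simp add: W_increment_moments st)
  qed simp
  then show ?int1 ?mean ?int2 ?var by blast+
qed

end

section \<open>The Ito isometry\<close>

lemma elementary_data_le:
  assumes "elementary_data a t F M n \<tau> \<xi>" "i \<le> j" "j \<le> n"
  shows "\<tau> i \<le> \<tau> j"
  using assms(2,3)
proof (induction j rule: dec_induct)
  case (step j)
  then have "\<tau> j \<le> \<tau> (Suc j)"
    using assms(1) by (simp add: elementary_data_def)
  with step show ?case by simp
qed simp

lemma elementary_data_bounds:
  assumes "elementary_data a t F M n \<tau> \<xi>" "i \<le> n"
  shows "a \<le> \<tau> i" "\<tau> i \<le> t"
  using elementary_data_le[OF assms(1), of 0 i] elementary_data_le[OF assms(1), of i n] assms
  by (auto simp: elementary_data_def)

lemma elementary_process_eq_0: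
  assumes "elementary_data a t F M n \<tau> \<xi>" "s \<notin> {a<..t}"
  shows "elementary_process n \<tau> \<xi> s \<omega> = 0"
  unfolding elementary_process_def
proof (rule sum.neutral, rule ballI)
  fix i assume "i \<in> {..<n}"
  then have "a \<le> \<tau> i" "\<tau> (Suc i) \<le> t"
    using elementary_data_bounds[OF assms(1)] by auto
  then have "s \<notin> {\<tau> i<..\<tau> (Suc i)}"
    using assms(2) by auto
  then show "\<xi> i \<omega> * indicator {\<tau> i<..\<tau> (Suc i)} s = 0" by simp
qed

lemma elementary_data_init:
  "elementary_data a t F M (Suc n) \<tau> \<xi> \<Longrightarrow> elementary_data a (\<tau> n) F M n \<tau> \<xi>"
  by (auto simp: elementary_data_def)

text \<open>The intervals of the partition are disjoint, so all mixed products vanish.\<close>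

lemma elementary_process_square:
  assumes "elementary_data a t F M n \<tau> \<xi>"
  shows "(elementary_process n \<tau> \<xi> s \<omega>)\<^sup>2 = (\<Sum>i<n. (\<xi> i \<omega>)\<^sup>2 * indicator {\<tau> i<..\<tau> (Suc i)} s)"
  using assms
proof (induction n arbitrary: t)
  case (Suc n)
  note init = elementary_data_init[OF Suc.prems]
  have "elementary_process n \<tau> \<xi> s \<omega> * indicator {\<tau> n<..\<tau> (Suc n)} s = 0"
    using elementary_process_eq_0[OF init, of s \<omega>] by (cases "s \<le> \<tau> n") auto
  moreover have "elementary_process (Suc n) \<tau> \<xi> s \<omega>
      = elementary_process n \<tau> \<xi> s \<omega> + \<xi> n \<omega> * indicator {\<tau> n<..\<tau> (Suc n)} s"
    by (simp add: elementary_process_def)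
  ultimately show ?case
    using Suc.IH[OF init] by (auto simp: indicator_def power2_eq_square)
qed (simp add: elementary_process_def)

context wiener_process
begin

lemma elementary_weight:
  assumes "0 \<le> a" "elementary_data a t F M n \<tau> \<xi>" "i < n"
  shows "\<xi> i \<in> borel_measurable (F (\<tau> i))" "\<xi> i \<in> borel_measurable M"
    "integrable M (\<lambda>\<omega>. (\<xi> i \<omega>)\<^sup>2)"
proof -
  show meas: "\<xi> i \<in> borel_measurable (F (\<tau> i))"
    using assms by (simp add: elementary_data_def)
  have "0 \<le> \<tau> i"
    using elementary_data_bounds[OF assms(2), of i] assms by simp
  then show M: "\<xi> i \<in> borel_measurable M"
    using meas by (rule measurable_F_imp_measurable)
  obtain B where B: "\<And>\<omega>. \<omega> \<in> space M \<Longrightarrow> \<bar>\<xi> i \<omega>\<bar> \<le> B"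
    using assms unfolding elementary_data_def by blast
  show "integrable M (\<lambda>\<omega>. (\<xi> i \<omega>)\<^sup>2)"
  proof (rule integrable_const_bound)
    show "AE \<omega> in M. norm ((\<xi> i \<omega>)\<^sup>2) \<le> B\<^sup>2"
    proof (rule AE_I2)
      fix \<omega> assume "\<omega> \<in> space M"
      from power_mono[OF B[OF this], of 2] show "norm ((\<xi> i \<omega>)\<^sup>2) \<le> B\<^sup>2" by simp
    qed
  qed (use M in simp)
qed

text \<open>Add one interval at a time: the partial sum and the new weight are known at time \<open>\<tau> n\<close>, so the mixed
  term has mean zero and only the diagonal term \<open>\<xi> n\<^sup>2 * (\<tau> (Suc n) - \<tau> n)\<close> is added. Starting the sum at
  the constant \<open>c\<close> instead of \<open>0\<close> makes the second moment of \<open>c + I\<close> available in the limit without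
  a separate proof that \<open>I\<close> is centred.\<close>

lemma elementary_integral_second_moment:
  assumes a: "0 \<le> a" and el: "elementary_data a t F M n \<tau> \<xi>"
  shows "(\<lambda>\<omega>. c + elementary_integral W n \<tau> \<xi> \<omega>) \<in> borel_measurable (F t)"
    and "integrable M (\<lambda>\<omega>. (c + elementary_integral W n \<tau> \<xi> \<omega>)\<^sup>2)"
    and "expectation (\<lambda>\<omega>. (c + elementary_integral W n \<tau> \<xi> \<omega>)\<^sup>2)
      = c\<^sup>2 + (\<Sum>i<n. expectation (\<lambda>\<omega>. (\<xi> i \<omega>)\<^sup>2) * (\<tau> (Suc i) - \<tau> i))"
proof -
  let ?S = "\<lambda>n \<omega>. c + elementary_integral W n \<tau> \<xi> \<omega>"
  have "?S n \<in> borel_measurable (F t) \<and> integrable M (\<lambda>\<omega>. (?S n \<omega>)\<^sup>2) \<and>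
    expectation (\<lambda>\<omega>. (?S n \<omega>)\<^sup>2)
      = c\<^sup>2 + (\<Sum>i<n. expectation (\<lambda>\<omega>. (\<xi> i \<omega>)\<^sup>2) * (\<tau> (Suc i) - \<tau> i))"
    using el
  proof (induction n arbitrary: t)
    case 0
    then show ?case by (simp add: elementary_integral_def prob_space)
  next
    case (Suc n)
    let ?D = "\<lambda>\<omega>. W (\<tau> (Suc n)) \<omega> - W (\<tau> n) \<omega>"
    note IH = Suc.IH[OF elementary_data_init[OF Suc.prems]]
    have \<tau>: "0 \<le> \<tau> n" "\<tau> n \<le> \<tau> (Suc n)" "\<tau> (Suc n) = t"
      using elementary_data_bounds(1)[OF Suc.prems, of n] Suc.prems a
      by (auto simp: elementary_data_def)
    note \<xi> = elementary_weight[OF a Suc.prems lessI]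
    have S: "?S n \<in> borel_measurable (F (\<tau> n))" "?S n \<in> borel_measurable M"
      using IH measurable_F_imp_measurable[OF \<tau>(1)] by auto
    have S\<xi>: "integrable M (\<lambda>\<omega>. ?S n \<omega> * \<xi> n \<omega>)"
      using S \<xi> IH by (intro integrable_mult_of_squares) auto
    have S\<xi>_meas: "(\<lambda>\<omega>. ?S n \<omega> * \<xi> n \<omega>) \<in> borel_measurable (F (\<tau> n))"
      "(\<lambda>\<omega>. (\<xi> n \<omega>)\<^sup>2) \<in> borel_measurable (F (\<tau> n))"
      using S(1) \<xi>(1) by (auto intro: borel_measurable_times borel_measurable_power)
    note cross = expectation_mult_W_increment(1,2)[OF \<tau>(1,2) S\<xi>_meas(1) S\<xi>]
    note diag = expectation_mult_W_increment(3,4)[OF \<tau>(1,2) S\<xi>_meas(2) \<xi>(3)]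
    have step: "?S (Suc n) \<omega> = ?S n \<omega> + \<xi> n \<omega> * ?D \<omega>" for \<omega>
      by (simp add: elementary_integral_def)
    have square: "(?S (Suc n) \<omega>)\<^sup>2
        = (?S n \<omega>)\<^sup>2 + 2 * (?S n \<omega> * \<xi> n \<omega> * ?D \<omega>) + (\<xi> n \<omega>)\<^sup>2 * (?D \<omega>)\<^sup>2" for \<omega>
      unfolding step by (simp add: power2_eq_square algebra_simps)
    have "W (\<tau> (Suc n)) \<in> borel_measurable (F t)" "W (\<tau> n) \<in> borel_measurable (F t)"
      "?S n \<in> borel_measurable (F t)" "\<xi> n \<in> borel_measurable (F t)"
      using \<tau> adapted[of "\<tau> n"] adapted[of t] S(1) \<xi>(1) measurable_F_mono[of "\<tau> n" t] by auto
    then have "?S (Suc n) \<in> borel_measurable (F t)"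
      unfolding step
      by (intro borel_measurable_add[of "?S n"] borel_measurable_times borel_measurable_diff)
    moreover have "integrable M (\<lambda>\<omega>. (?S (Suc n) \<omega>)\<^sup>2)"
      unfolding square using IH cross(1) diag(1)
      by (intro Bochner_Integration.integrable_add integrable_mult_right) auto
    moreover have "expectation (\<lambda>\<omega>. (?S (Suc n) \<omega>)\<^sup>2)
        = expectation (\<lambda>\<omega>. (?S n \<omega>)\<^sup>2) + expectation (\<lambda>\<omega>. (\<xi> n \<omega>)\<^sup>2) * (\<tau> (Suc n) - \<tau> n)"
      unfolding square using IH cross diag by simp
    ultimately show ?case
      using IH by simp
  qed
  then show "?S n \<in> borel_measurable (F t)" "integrable M (\<lambda>\<omega>. (?S n \<omega>)\<^sup>2)"
    "expectation (\<lambda>\<omega>. (?S n \<omega>)\<^sup>2)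
      = c\<^sup>2 + (\<Sum>i<n. expectation (\<lambda>\<omega>. (\<xi> i \<omega>)\<^sup>2) * (\<tau> (Suc i) - \<tau> i))"
    by blast+
qed

lemma measurable_elementary_process:
  assumes "0 \<le> a" "elementary_data a t F M n \<tau> \<xi>"
  shows "(\<lambda>(s, \<omega>). elementary_process n \<tau> \<xi> s \<omega>) \<in> borel_measurable (lborel \<Otimes>\<^sub>M M)"
  unfolding elementary_process_def split_def
proof (intro borel_measurable_sum borel_measurable_times)
  fix i assume "i \<in> {..<n}"
  with assms have [measurable]: "\<xi> i \<in> borel_measurable M"
    by (intro elementary_weight) auto
  show "(\<lambda>x. \<xi> i (snd x)) \<in> borel_measurable (lborel \<Otimes>\<^sub>M M)"
    by measurable
  show "(\<lambda>x. indicator {\<tau> i<..\<tau> (Suc i)} (fst x)) \<in> borel_measurable (lborel \<Otimes>\<^sub>M M)"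
    by measurable
qed

lemma nn_integral_elementary_process_square:
  assumes a: "0 \<le> a" and el: "elementary_data a t F M n \<tau> \<xi>"
  shows "(\<integral>\<^sup>+(s, \<omega>). ennreal ((elementary_process n \<tau> \<xi> s \<omega>)\<^sup>2) \<partial>(lborel \<Otimes>\<^sub>M M))
    = ennreal (\<Sum>i<n. expectation (\<lambda>\<omega>. (\<xi> i \<omega>)\<^sup>2) * (\<tau> (Suc i) - \<tau> i))"
proof -
  have weight_term: "(\<integral>\<^sup>+z. ennreal ((\<xi> i (snd z))\<^sup>2 * indicator {\<tau> i<..\<tau> (Suc i)} (fst z)) \<partial>(lborel \<Otimes>\<^sub>M M))
      = ennreal (expectation (\<lambda>\<omega>. (\<xi> i \<omega>)\<^sup>2) * (\<tau> (Suc i) - \<tau> i))" (is "?lhs = _")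
    and meas: "(\<lambda>z. ennreal ((\<xi> i (snd z))\<^sup>2 * indicator {\<tau> i<..\<tau> (Suc i)} (fst z)))
      \<in> borel_measurable (lborel \<Otimes>\<^sub>M M)"
    if i: "i < n" for i
  proof -
    note \<xi> = elementary_weight[OF a el i]
    note [measurable] = \<xi>(2)
    have \<tau>: "\<tau> i \<le> \<tau> (Suc i)"
      using el i by (simp add: elementary_data_def)
    show "(\<lambda>z. ennreal ((\<xi> i (snd z))\<^sup>2 * indicator {\<tau> i<..\<tau> (Suc i)} (fst z)))
      \<in> borel_measurable (lborel \<Otimes>\<^sub>M M)"
      by measurable
    have "?lhs = (\<integral>\<^sup>+s. (\<integral>\<^sup>+\<omega>. ennreal ((\<xi> i \<omega>)\<^sup>2 * indicator {\<tau> i<..\<tau> (Suc i)} s) \<partial>M) \<partial>lborel)"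
      by (subst nn_integral_fst[symmetric]) (simp_all, measurable)
    also have "\<dots> = (\<integral>\<^sup>+s. ennreal (expectation (\<lambda>\<omega>. (\<xi> i \<omega>)\<^sup>2))
        * indicator {\<tau> i<..\<tau> (Suc i)} s \<partial>lborel)"
      using \<xi>(3) by (intro nn_integral_cong) (auto simp: nn_integral_eq_integral indicator_def)
    also have "\<dots> = ennreal (expectation (\<lambda>\<omega>. (\<xi> i \<omega>)\<^sup>2)) * ennreal (\<tau> (Suc i) - \<tau> i)"
      using \<tau> by (subst nn_integral_cmult_indicator) auto
    finally show "?lhs = ennreal (expectation (\<lambda>\<omega>. (\<xi> i \<omega>)\<^sup>2) * (\<tau> (Suc i) - \<tau> i))"
      using \<tau> by (simp add: ennreal_mult)
  qed
  have "(\<integral>\<^sup>+(s, \<omega>). ennreal ((elementary_process n \<tau> \<xi> s \<omega>)\<^sup>2) \<partial>(lborel \<Otimes>\<^sub>M M))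
      = (\<integral>\<^sup>+z. (\<Sum>i<n. ennreal ((\<xi> i (snd z))\<^sup>2 * indicator {\<tau> i<..\<tau> (Suc i)} (fst z))) \<partial>(lborel \<Otimes>\<^sub>M M))"
    by (intro nn_integral_cong) (simp add: elementary_process_square[OF el] split_def sum_ennreal)
  also have "\<dots> = (\<Sum>i<n. ennreal (expectation (\<lambda>\<omega>. (\<xi> i \<omega>)\<^sup>2) * (\<tau> (Suc i) - \<tau> i)))"
    using weight_term meas by (subst nn_integral_sum) auto
  also have "\<dots> = ennreal (\<Sum>i<n. expectation (\<lambda>\<omega>. (\<xi> i \<omega>)\<^sup>2) * (\<tau> (Suc i) - \<tau> i))"
    using el by (intro sum_ennreal) (auto simp: elementary_data_def)
  finally show ?thesis .
qed

text \<open>Every generator of the predictable \<sigma>-algebra is a measurable rectangle. The indicator extends the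
  process by zero to all of \<open>\<real> \<times> \<Omega>\<close>, where Fubini's theorem is available.\<close>

lemma measurable_predictable:
  assumes a: "0 \<le> a" and H: "predictable a F M H"
  shows "(\<lambda>(s, \<omega>). indicator {a..t} s * H s \<omega>) \<in> borel_measurable (lborel \<Otimes>\<^sub>M M)"
proof -
  let ?R = "restrict_space (lborel \<Otimes>\<^sub>M M) ({a..} \<times> space M)"
  let ?gen = "{{a} \<times> A | A. A \<in> sets (F a)} \<union>
    {{s<..t} \<times> A | s t A. a \<le> s \<and> s < t \<and> A \<in> sets (F s)}"
  have F: "A \<in> sets M" if "A \<in> sets (F s)" "a \<le> s" for A s
    using sets_F_subset[of s] that a by auto
  have "(\<lambda>z. z) \<in> ?R \<rightarrow>\<^sub>M predictable_sigma a F M"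
    unfolding predictable_sigma_def
  proof (rule measurable_measure_of)
    show "?gen \<subseteq> Pow ({a..} \<times> space M)"
      using F sets.sets_into_space by fastforce
    show "(\<lambda>z. z) \<in> space ?R \<rightarrow> {a..} \<times> space M"
      by (auto simp: space_restrict_space)
    fix B assume B: "B \<in> ?gen"
    then have "B \<in> sets (lborel \<Otimes>\<^sub>M M)"
      using F by auto
    then show "(\<lambda>z. z) -` B \<inter> space ?R \<in> sets ?R"
      by (auto simp: space_restrict_space sets_restrict_space space_pair_measure)
  qed
  then have "(\<lambda>(s, \<omega>). H s \<omega>) \<in> borel_measurable ?R"
    using H unfolding predictable_def by (rule measurable_compose)
  then have "(\<lambda>z. indicator ({a..} \<times> space M) z *\<^sub>R (case z of (s, \<omega>) \<Rightarrow> H s \<omega>))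
      \<in> borel_measurable (lborel \<Otimes>\<^sub>M M)"
    by (subst (asm) borel_measurable_restrict_space_iff) (auto simp: space_pair_measure)
  then have "(\<lambda>z. indicator {a..t} (fst z) *
      (indicator ({a..} \<times> space M) z *\<^sub>R (case z of (s, \<omega>) \<Rightarrow> H s \<omega>))) \<in> borel_measurable (lborel \<Otimes>\<^sub>M M)"
    by measurable
  then show ?thesis
    by (rule measurable_cong[THEN iffD1, rotated])
      (auto simp: space_pair_measure indicator_def split: if_splits)
qed

text \<open>For elementary processes both sides agree by the computations above. The left side passes to the limit
  by convergence in \<open>L\<^sup>2(M)\<close>, the right side by convergence in \<open>L\<^sup>2\<close> of the product of Lebesgue measure
  and \<open>M\<close>.\<close>

lemma ito_isometry:
  assumes a: "0 \<le> a" and I: "has_ito_integral M F W a t H I"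
  shows "integrable M (\<lambda>\<omega>. (c + I \<omega>)\<^sup>2)"
    and "ennreal (expectation (\<lambda>\<omega>. (c + I \<omega>)\<^sup>2))
      = ennreal (c\<^sup>2) + (\<integral>\<^sup>+s\<in>{a..t}. (\<integral>\<^sup>+\<omega>. ennreal ((H s \<omega>)\<^sup>2) \<partial>M) \<partial>lborel)"
proof -
  let ?P = "lborel \<Otimes>\<^sub>M M"
  from I obtain n \<tau> \<xi> where
    pred: "predictable a F M H" and [measurable]: "I \<in> borel_measurable M" and
    el: "\<And>k. elementary_data a t F M (n k) (\<tau> k) (\<xi> k)" and
    H_lim: "(\<lambda>k. \<integral>\<^sup>+s\<in>{a..t}. (\<integral>\<^sup>+\<omega>. ennreal
      ((elementary_process (n k) (\<tau> k) (\<xi> k) s \<omega> - H s \<omega>)\<^sup>2) \<partial>M) \<partial>lborel) \<longlonglongrightarrow> 0" and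
    I_lim: "(\<lambda>k. \<integral>\<^sup>+\<omega>. ennreal
      ((elementary_integral W (n k) (\<tau> k) (\<xi> k) \<omega> - I \<omega>)\<^sup>2) \<partial>M) \<longlonglongrightarrow> 0"
    unfolding has_ito_integral_def by blast
  define J where "J k \<omega> = c + elementary_integral W (n k) (\<tau> k) (\<xi> k) \<omega>" for k \<omega>
  define E where "E k = (\<lambda>(s, \<omega>). elementary_process (n k) (\<tau> k) (\<xi> k) s \<omega>)" for k
  define HP where "HP = (\<lambda>(s, \<omega>). indicator {a..t} s * H s \<omega>)"
  have t: "0 \<le> t"
    using elementary_data_bounds(1)[OF el, of "n 0" 0] el[of 0] a by (simp add: elementary_data_def)
  have J_meas: "J k \<in> borel_measurable M" for k
    unfolding J_def using elementary_integral_second_moment(1)[OF a el]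
    by (rule measurable_F_imp_measurable[OF t])
  have J_int: "integrable M (\<lambda>\<omega>. (J k \<omega>)\<^sup>2)" for k
    unfolding J_def by (rule elementary_integral_second_moment(2)[OF a el])
  have J_lim: "(\<lambda>k. \<integral>\<^sup>+\<omega>. ennreal ((J k \<omega> - (c + I \<omega>))\<^sup>2) \<partial>M) \<longlonglongrightarrow> 0"
    using I_lim by (simp add: J_def)
  have cI_meas: "(\<lambda>\<omega>. c + I \<omega>) \<in> borel_measurable M"
    by measurable
  show cI_int: "integrable M (\<lambda>\<omega>. (c + I \<omega>)\<^sup>2)"
    by (rule square_integrable_L2_limit[OF _ cI_meas J_meas J_int J_lim]) simp
  have E_J: "(\<lambda>k. expectation (\<lambda>\<omega>. (J k \<omega>)\<^sup>2)) \<longlonglongrightarrow> expectation (\<lambda>\<omega>. (c + I \<omega>)\<^sup>2)"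
    by (rule tendsto_integral_square[OF cI_meas cI_int _ J_lim]) (simp add: J_meas J_int)
  have E_meas: "E k \<in> borel_measurable ?P" for k
    unfolding E_def by (rule measurable_elementary_process[OF a el])
  have HP_meas: "HP \<in> borel_measurable ?P"
    unfolding HP_def by (rule measurable_predictable[OF a pred])
  define m where "m k = (\<Sum>i<n k. expectation (\<lambda>\<omega>. (\<xi> k i \<omega>)\<^sup>2) * (\<tau> k (Suc i) - \<tau> k i))" for k
  have m_nonneg: "0 \<le> m k" for k
    unfolding m_def using el[of k] by (intro sum_nonneg) (auto simp: elementary_data_def)
  have E_nn: "(\<integral>\<^sup>+z. ennreal ((E k z)\<^sup>2) \<partial>?P) = ennreal (m k)" for k
    using nn_integral_elementary_process_square[OF a el, of k]
    by (simp add: E_def m_def split_def)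
  have E_int: "integrable ?P (\<lambda>z. (E k z)\<^sup>2)" for k
    using E_meas[of k] E_nn[of k] by (intro integrableI_bounded) auto
  have E_eq: "(\<integral>z. (E k z)\<^sup>2 \<partial>?P) = m k" for k
    using E_nn[of k] m_nonneg E_meas[of k] by (subst integral_eq_nn_integral) auto
  have iterate: "(\<integral>\<^sup>+z. ennreal ((f z)\<^sup>2) \<partial>?P) = (\<integral>\<^sup>+s\<in>{a..t}. (\<integral>\<^sup>+\<omega>. ennreal ((g s \<omega>)\<^sup>2) \<partial>M) \<partial>lborel)"
    if "f \<in> borel_measurable ?P" and f: "\<And>s \<omega>. f (s, \<omega>) = indicator {a..t} s * g s \<omega>" for f g
    using that(1)
    by (subst nn_integral_fst[symmetric])
      (auto intro!: nn_integral_cong simp: f indicator_def)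
  have "(\<integral>\<^sup>+z. ennreal ((E k z - HP z)\<^sup>2) \<partial>?P) = (\<integral>\<^sup>+s\<in>{a..t}. (\<integral>\<^sup>+\<omega>. ennreal
      ((elementary_process (n k) (\<tau> k) (\<xi> k) s \<omega> - H s \<omega>)\<^sup>2) \<partial>M) \<partial>lborel)" for k
    using E_meas HP_meas elementary_process_eq_0[OF el[of k]]
    by (intro iterate) (auto simp: E_def HP_def indicator_def)
  with H_lim have HP_lim: "(\<lambda>k. \<integral>\<^sup>+z. ennreal ((E k z - HP z)\<^sup>2) \<partial>?P) \<longlonglongrightarrow> 0"
    by simp
  have HP_int: "integrable ?P (\<lambda>z. (HP z)\<^sup>2)"
    by (rule square_integrable_L2_limit[OF _ HP_meas E_meas E_int HP_lim]) simp
  have "(\<lambda>k. \<integral>z. (E k z)\<^sup>2 \<partial>?P) \<longlonglongrightarrow> (\<integral>z. (HP z)\<^sup>2 \<partial>?P)"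
    by (rule tendsto_integral_square[OF HP_meas HP_int _ HP_lim]) (simp add: E_meas E_int)
  then have "(\<lambda>k. c\<^sup>2 + m k) \<longlonglongrightarrow> c\<^sup>2 + (\<integral>z. (HP z)\<^sup>2 \<partial>?P)"
    unfolding E_eq by (intro tendsto_intros)
  moreover have "expectation (\<lambda>\<omega>. (J k \<omega>)\<^sup>2) = c\<^sup>2 + m k" for k
    unfolding J_def m_def by (rule elementary_integral_second_moment(3)[OF a el])
  ultimately have "expectation (\<lambda>\<omega>. (c + I \<omega>)\<^sup>2) = c\<^sup>2 + (\<integral>z. (HP z)\<^sup>2 \<partial>?P)"
    using E_J LIMSEQ_unique by simp
  also have "ennreal \<dots> = ennreal (c\<^sup>2) + (\<integral>\<^sup>+z. ennreal ((HP z)\<^sup>2) \<partial>?P)"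
    using HP_int by (simp add: nn_integral_eq_integral)
  also have "(\<integral>\<^sup>+z. ennreal ((HP z)\<^sup>2) \<partial>?P)
      = (\<integral>\<^sup>+s\<in>{a..t}. (\<integral>\<^sup>+\<omega>. ennreal ((H s \<omega>)\<^sup>2) \<partial>M) \<partial>lborel)"
    using HP_meas by (rule iterate) (simp add: HP_def)
  finally show "ennreal (expectation (\<lambda>\<omega>. (c + I \<omega>)\<^sup>2))
      = ennreal (c\<^sup>2) + (\<integral>\<^sup>+s\<in>{a..t}. (\<integral>\<^sup>+\<omega>. ennreal ((H s \<omega>)\<^sup>2) \<partial>M) \<partial>lborel)" .
qed

end

section \<open>Second moments of mild solutions\<close>

lemma L2_continuous_second_moment:
  assumes u: "L2_continuous M a u"
  shows "continuous_on {a..} (\<lambda>t. \<integral>\<omega>. (u x t \<omega>)\<^sup>2 \<partial>M)"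
  unfolding continuous_on_def
proof
  fix t assume "t \<in> {a..}"
  then have t: "a \<le> t" by simp
  have L2: "u x s \<in> borel_measurable M" "integrable M (\<lambda>\<omega>. (u x s \<omega>)\<^sup>2)" if "a \<le> s" for s
    using u that by (auto simp: L2_continuous_def)
  have in_domain: "\<forall>\<^sub>F s in at t within {a..}. a \<le> s"
    by (simp add: eventually_at_filter)
  have "((\<lambda>(y, s). sqrt (\<integral>\<omega>. \<bar>u y s \<omega> - u x t \<omega>\<bar>\<^sup>2 \<partial>M)) \<longlongrightarrow> 0) (at (x, t) within UNIV \<times> {a..})"
    using u t by (simp add: L2_continuous_def)
  moreover have "filterlim (\<lambda>s. (x, s)) (at (x, t) within UNIV \<times> {a..}) (at t within {a..})"
    unfolding filterlim_at
    by (intro conjI tendsto_intros) (auto simp: eventually_at_filter)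
  ultimately have "((\<lambda>s. sqrt (\<integral>\<omega>. \<bar>u x s \<omega> - u x t \<omega>\<bar>\<^sup>2 \<partial>M)) \<longlongrightarrow> 0) (at t within {a..})"
    by (auto dest: filterlim_compose)
  then have "((\<lambda>s. (sqrt (\<integral>\<omega>. \<bar>u x s \<omega> - u x t \<omega>\<bar>\<^sup>2 \<partial>M))\<^sup>2) \<longlongrightarrow> 0\<^sup>2) (at t within {a..})"
    by (rule tendsto_power)
  then have "((\<lambda>s. ennreal (\<integral>\<omega>. (u x s \<omega> - u x t \<omega>)\<^sup>2 \<partial>M)) \<longlongrightarrow> ennreal 0) (at t within {a..})"
    by (intro tendsto_ennrealI) simp
  moreover have "\<forall>\<^sub>F s in at t within {a..}. ennreal (\<integral>\<omega>. (u x s \<omega> - u x t \<omega>)\<^sup>2 \<partial>M)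
      = (\<integral>\<^sup>+\<omega>. ennreal ((u x s \<omega> - u x t \<omega>)\<^sup>2) \<partial>M)"
    using in_domain
    by eventually_elim (auto intro!: nn_integral_eq_integral[symmetric] integrable_square_diff L2 t)
  ultimately have "((\<lambda>s. \<integral>\<^sup>+\<omega>. ennreal ((u x s \<omega> - u x t \<omega>)\<^sup>2) \<partial>M) \<longlongrightarrow> 0) (at t within {a..})"
    by (auto elim!: Lim_transform_eventually)
  then show "((\<lambda>s. \<integral>\<omega>. (u x s \<omega>)\<^sup>2 \<partial>M) \<longlongrightarrow> (\<integral>\<omega>. (u x t \<omega>)\<^sup>2 \<partial>M)) (at t within {a..})"
    by (intro tendsto_integral_square L2 t) (auto intro: eventually_mono[OF in_domain] L2)
qed

lemma (in wiener_process) mild_solution_second_moment: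
  assumes a: "0 \<le> a" and l: "0 < l" and \<sigma>: "\<sigma> \<in> borel_measurable borel"
    and sol: "mild_solution M F W a \<alpha> \<sigma> l u0 u" and u: "L2_continuous M a u" and t: "a \<le> t"
  shows "ennreal (expectation (\<lambda>\<omega>. (u x t \<omega>)\<^sup>2)) = ennreal ((u0 x)\<^sup>2) +
    ennreal (l\<^sup>2) * (\<integral>\<^sup>+s\<in>{a..t}. ennreal ((s - a) powr (2 * (\<alpha> - 1))) *
      (\<integral>\<^sup>+\<omega>. ennreal ((\<sigma> (u x s \<omega>))\<^sup>2) \<partial>M) \<partial>lborel)"
proof -
  have u_meas: "u x s \<in> borel_measurable M" if "a \<le> s" for s
    using u that by (simp add: L2_continuous_def)
  obtain I where I: "has_ito_integral M F W a t (\<lambda>s \<omega>. (s - a) powr (\<alpha> - 1) * \<sigma> (u x s \<omega>)) I"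
    and uI: "AE \<omega> in M. u x t \<omega> = u0 x + l * I \<omega>"
    using sol t unfolding mild_solution_def by blast
  have [measurable]: "I \<in> borel_measurable M"
    using I by (simp add: has_ito_integral_def)
  \<comment> \<open>Factor \<open>l\<close> out of \<open>u0 x + l * I\<close>, so that the isometry applies with the constant \<open>u0 x / l\<close>.\<close>
  have "expectation (\<lambda>\<omega>. (u x t \<omega>)\<^sup>2) = expectation (\<lambda>\<omega>. l\<^sup>2 * (u0 x / l + I \<omega>)\<^sup>2)"
  proof (rule integral_cong_AE)
    show "AE \<omega> in M. (u x t \<omega>)\<^sup>2 = l\<^sup>2 * (u0 x / l + I \<omega>)\<^sup>2"
      using uI by eventually_elim (use l in \<open>simp add: power_mult_distrib[symmetric] distrib_left\<close>)
  qed (use u_meas[OF t] in measurable)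
  then have "ennreal (expectation (\<lambda>\<omega>. (u x t \<omega>)\<^sup>2))
      = ennreal (l\<^sup>2) * ennreal (expectation (\<lambda>\<omega>. (u0 x / l + I \<omega>)\<^sup>2))"
    by (simp add: ennreal_mult)
  also have "\<dots> = ennreal (l\<^sup>2) * (ennreal ((u0 x / l)\<^sup>2) +
      (\<integral>\<^sup>+s\<in>{a..t}. (\<integral>\<^sup>+\<omega>. ennreal (((s - a) powr (\<alpha> - 1) * \<sigma> (u x s \<omega>))\<^sup>2) \<partial>M) \<partial>lborel))"
    by (subst ito_isometry(2)[OF a I]) rule
  also have "(\<integral>\<^sup>+s\<in>{a..t}. (\<integral>\<^sup>+\<omega>. ennreal (((s - a) powr (\<alpha> - 1) * \<sigma> (u x s \<omega>))\<^sup>2) \<partial>M) \<partial>lborel)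
    = (\<integral>\<^sup>+s\<in>{a..t}. ennreal ((s - a) powr (2 * (\<alpha> - 1))) *
      (\<integral>\<^sup>+\<omega>. ennreal ((\<sigma> (u x s \<omega>))\<^sup>2) \<partial>M) \<partial>lborel)"
  proof (intro nn_integral_cong)
    fix s :: real
    have weight: "((s - a) powr (\<alpha> - 1))\<^sup>2 = (s - a) powr (2 * (\<alpha> - 1))"
      by (simp add: power2_eq_square powr_add[symmetric])
    have "(\<integral>\<^sup>+\<omega>. ennreal (((s - a) powr (\<alpha> - 1) * \<sigma> (u x s \<omega>))\<^sup>2) \<partial>M) =
      ennreal ((s - a) powr (2 * (\<alpha> - 1))) * (\<integral>\<^sup>+\<omega>. ennreal ((\<sigma> (u x s \<omega>))\<^sup>2) \<partial>M)" if "a \<le> s"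
      using u_meas[OF that] \<sigma>
      by (subst nn_integral_cmult[symmetric])
        (auto simp: power_mult_distrib ennreal_mult weight)
    then show "(\<integral>\<^sup>+\<omega>. ennreal (((s - a) powr (\<alpha> - 1) * \<sigma> (u x s \<omega>))\<^sup>2) \<partial>M) * indicator {a..t} s =
      ennreal ((s - a) powr (2 * (\<alpha> - 1))) * (\<integral>\<^sup>+\<omega>. ennreal ((\<sigma> (u x s \<omega>))\<^sup>2) \<partial>M) * indicator {a..t} s"
      by (auto simp: indicator_def)
  qed
  finally show ?thesis
    using l by (simp add: distrib_left ennreal_mult[symmetric] power_divide)
qed

text \<open>The growth conditions on \<open>\<sigma>\<close> squeeze \<open>E (\<sigma> (u x s))\<^sup>2\<close> between \<open>L\<^sup>2\<close> and \<open>K\<^sup>2\<close> times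
  \<open>g s = E (u x s)\<^sup>2\<close>. The second moment formula then becomes a pair of linear integral inequalities for
  \<open>g\<close>, and Gronwall's lemma solves each of them.\<close>

lemma (in wiener_process) second_moment_bounds:
  assumes a: "0 \<le> a" and \<alpha>: "1 / 2 < \<alpha>" and l: "0 < l"
    and \<sigma>: "\<sigma> \<in> borel_measurable borel"
    and \<sigma>_bounds: "\<And>x. L * \<bar>x\<bar> \<le> \<bar>\<sigma> x\<bar>" "\<And>x. \<bar>\<sigma> x\<bar> \<le> K * \<bar>x\<bar>" and L: "0 \<le> L" and K: "0 \<le> K"
    and sol: "mild_solution M F W a \<alpha> \<sigma> l u0 u" and u: "L2_continuous M a u" and t: "a \<le> t"
  shows "(u0 x)\<^sup>2 * exp (l\<^sup>2 * L\<^sup>2 * ((t - a) powr (2 * \<alpha> - 1) / (2 * \<alpha> - 1)))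
      \<le> expectation (\<lambda>\<omega>. (u x t \<omega>)\<^sup>2)" (is ?lower)
    and "expectation (\<lambda>\<omega>. (u x t \<omega>)\<^sup>2)
      \<le> (u0 x)\<^sup>2 * exp (l\<^sup>2 * K\<^sup>2 * ((t - a) powr (2 * \<alpha> - 1) / (2 * \<alpha> - 1)))" (is ?upper)
proof -
  define \<beta> where "\<beta> = 2 * (\<alpha> - 1)"
  define g where "g s = expectation (\<lambda>\<omega>. (u x s \<omega>)\<^sup>2)" for s
  define m where "m s = (\<integral>\<^sup>+\<omega>. ennreal ((\<sigma> (u x s \<omega>))\<^sup>2) \<partial>M)" for s
  have \<beta>: "- 1 < \<beta>" "\<beta> + 1 = 2 * \<alpha> - 1"
    using \<alpha> by (auto simp: \<beta>_def)
  have g_nonneg: "0 \<le> g s" for s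
    by (simp add: g_def)
  have g_cont: "continuous_on {a..} g"
    unfolding g_def by (rule L2_continuous_second_moment[OF u])
  from weighted_gronwall[OF \<beta>(1) g_cont g_nonneg] obtain G where
    G: "\<And>t k. \<lbrakk>a \<le> t; 0 \<le> k\<rbrakk> \<Longrightarrow>
      (\<integral>\<^sup>+s\<in>{a..t}. ennreal (k * ((s - a) powr \<beta> * g s)) \<partial>lborel) = ennreal (k * G t)"
    and G_nonneg: "\<And>t. a \<le> t \<Longrightarrow> 0 \<le> G t"
    and upper: "\<And>t p K. \<lbrakk>a \<le> t; 0 \<le> K; \<And>s. a \<le> s \<Longrightarrow> g s \<le> p + K * G s\<rbrakk>
      \<Longrightarrow> g t \<le> p * exp (K * ((t - a) powr (\<beta> + 1) / (\<beta> + 1)))"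
    and lower: "\<And>t p K. \<lbrakk>a \<le> t; 0 \<le> K; \<And>s. a \<le> s \<Longrightarrow> p + K * G s \<le> g s\<rbrakk>
      \<Longrightarrow> p * exp (K * ((t - a) powr (\<beta> + 1) / (\<beta> + 1))) \<le> g t"
    by blast
  have g_eq: "ennreal (g t) = ennreal ((u0 x)\<^sup>2) +
      ennreal (l\<^sup>2) * (\<integral>\<^sup>+s\<in>{a..t}. ennreal ((s - a) powr \<beta>) * m s \<partial>lborel)" if "a \<le> t" for t
    unfolding g_def m_def \<beta>_def by (rule mild_solution_second_moment[OF a l \<sigma> sol u that])
  have moment: "ennreal (k * g s) = (\<integral>\<^sup>+\<omega>. ennreal (k * (u x s \<omega>)\<^sup>2) \<partial>M)" if "a \<le> s" "0 \<le> k" for s k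
    using u that unfolding g_def L2_continuous_def
    by (subst nn_integral_eq_integral) auto
  have square_lower: "L\<^sup>2 * y\<^sup>2 \<le> (\<sigma> y)\<^sup>2" for y
    using power_mono[OF \<sigma>_bounds(1)[of y], of 2] L by (simp add: power_mult_distrib)
  have square_upper: "(\<sigma> y)\<^sup>2 \<le> K\<^sup>2 * y\<^sup>2" for y
    using power_mono[OF \<sigma>_bounds(2)[of y], of 2] by (simp add: power_mult_distrib)
  have m_lower: "ennreal (L\<^sup>2 * g s) \<le> m s" if "a \<le> s" for s
    using that square_lower unfolding m_def
    by (subst moment) (auto intro!: nn_integral_mono ennreal_leI)
  have m_upper: "m s \<le> ennreal (K\<^sup>2 * g s)" if "a \<le> s" for s
    using that square_upper unfolding m_def
    by (subst moment) (auto intro!: nn_integral_mono ennreal_leI)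
  have split_weight: "ennreal (k * ((s - a) powr \<beta> * g s)) = ennreal ((s - a) powr \<beta>) * ennreal (k * g s)"
    if "0 \<le> k" for k s
    using that g_nonneg by (simp add: ennreal_mult[symmetric] ac_simps)
  have g_lower: "(u0 x)\<^sup>2 + l\<^sup>2 * L\<^sup>2 * G s \<le> g s" if s: "a \<le> s" for s
  proof -
    have "ennreal (L\<^sup>2 * G s) \<le> (\<integral>\<^sup>+r\<in>{a..s}. ennreal ((r - a) powr \<beta>) * m r \<partial>lborel)"
      using m_lower s unfolding G[OF s zero_le_power2, symmetric]
      by (intro nn_integral_mono) (auto simp: split_weight indicator_def intro: mult_left_mono)
    then have "ennreal ((u0 x)\<^sup>2) + ennreal (l\<^sup>2) * ennreal (L\<^sup>2 * G s) \<le> ennreal (g s)"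
      unfolding g_eq[OF s] by (intro add_left_mono mult_left_mono) auto
    then show ?thesis
      using G_nonneg[OF s] g_nonneg
      by (simp add: ennreal_mult[symmetric] ennreal_plus[symmetric] mult.assoc del: ennreal_plus)
  qed
  have g_upper: "g s \<le> (u0 x)\<^sup>2 + l\<^sup>2 * K\<^sup>2 * G s" if s: "a \<le> s" for s
  proof -
    have "(\<integral>\<^sup>+r\<in>{a..s}. ennreal ((r - a) powr \<beta>) * m r \<partial>lborel) \<le> ennreal (K\<^sup>2 * G s)"
      using m_upper s unfolding G[OF s zero_le_power2, symmetric]
      by (intro nn_integral_mono) (auto simp: split_weight indicator_def intro: mult_left_mono)
    then have "ennreal (g s) \<le> ennreal ((u0 x)\<^sup>2) + ennreal (l\<^sup>2) * ennreal (K\<^sup>2 * G s)"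
      unfolding g_eq[OF s] by (intro add_left_mono mult_left_mono) auto
    then show ?thesis
      using G_nonneg[OF s] g_nonneg
      by (simp add: ennreal_mult[symmetric] ennreal_plus[symmetric] mult.assoc del: ennreal_plus)
  qed
  show ?lower
    using lower[OF t _ g_lower] by (simp add: \<beta>(2) g_def[symmetric])
  show ?upper
    using upper[OF t _ g_upper] by (simp add: \<beta>(2) g_def[symmetric])
qed

section \<open>Growth in the noise intensity\<close>

lemma log_exponential_rate_tendsto:
  fixes p B :: real
  assumes "0 < p"
  shows "((\<lambda>l. ereal (ln (p * exp (l\<^sup>2 * B)) / l\<^sup>2)) \<longlongrightarrow> ereal B) at_top"
proof -
  have "((\<lambda>l. ln p / l\<^sup>2 + B) \<longlongrightarrow> 0 + B) at_top"
    by (intro tendsto_intros tendsto_divide_0[OF tendsto_const] filterlim_at_top_imp_at_infinity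
        filterlim_pow_at_top filterlim_ident) simp
  moreover have "\<forall>\<^sub>F l in at_top. ln p / l\<^sup>2 + B = ln (p * exp (l\<^sup>2 * B)) / l\<^sup>2"
    using eventually_gt_at_top[of 0]
    by eventually_elim (use assms in \<open>simp add: ln_mult add_divide_distrib\<close>)
  ultimately have "((\<lambda>l. ln (p * exp (l\<^sup>2 * B)) / l\<^sup>2) \<longlongrightarrow> B) at_top"
    by (auto elim!: Lim_transform_eventually)
  then show ?thesis by simp
qed

theorem corollary3p13:
  fixes M :: "'a measure" and F :: "real \<Rightarrow> 'a measure" and W :: "real \<Rightarrow> 'a \<Rightarrow> real"
    and a \<alpha> c L Lip :: real and u0 \<sigma> :: "real \<Rightarrow> real"
    and u :: "real \<Rightarrow> real \<Rightarrow> real \<Rightarrow> 'a \<Rightarrow> real"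
  assumes W: "wiener_process M F W"
    and a: "a > 0" and \<alpha>: "1 / 2 < \<alpha>" "\<alpha> < 1"
    and u0_nonneg: "\<And>x. u0 x \<ge> 0" and u0_bounded: "bounded (range u0)"
    and c: "c > 0" and u0_lower: "\<And>x. u0 x > c"
    and \<sigma>0: "\<sigma> 0 = 0"
    and L: "L > 0" and Lip: "Lip > 0"
    and \<sigma>_lipschitz: "\<And>x y. \<bar>\<sigma> x - \<sigma> y\<bar> \<le> Lip * \<bar>x - y\<bar>"
    and \<sigma>_lower: "\<And>x. \<bar>\<sigma> x\<bar> \<ge> L * \<bar>x\<bar>"
    and solution: "\<And>l. l > 0 \<Longrightarrow> mild_solution M F W a \<alpha> \<sigma> l u0 (u l)"
    and continuity: "\<And>l. l > 0 \<Longrightarrow> L2_continuous M a (u l)"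
  shows "(\<forall>x. \<forall>t>a.
      ereal (L\<^sup>2 * (t - a) powr (2 * \<alpha> - 1) / (2 * \<alpha> - 1))
        \<le> Liminf at_top (\<lambda>l. ereal (ln (\<integral>\<omega>. \<bar>u l x t \<omega>\<bar>\<^sup>2 \<partial>M) / l\<^sup>2)) \<and>
      Liminf at_top (\<lambda>l. ereal (ln (\<integral>\<omega>. \<bar>u l x t \<omega>\<bar>\<^sup>2 \<partial>M) / l\<^sup>2))
        \<le> Limsup at_top (\<lambda>l. ereal (ln (\<integral>\<omega>. \<bar>u l x t \<omega>\<bar>\<^sup>2 \<partial>M) / l\<^sup>2)) \<and>
      Limsup at_top (\<lambda>l. ereal (ln (\<integral>\<omega>. \<bar>u l x t \<omega>\<bar>\<^sup>2 \<partial>M) / l\<^sup>2))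
        \<le> ereal (Lip\<^sup>2 * (t - a) powr (2 * \<alpha> - 1) / (2 * \<alpha> - 1))) \<and>
    (Lip = L \<longrightarrow> (\<forall>x. \<forall>t>a.
      Limsup at_top (\<lambda>l. ereal (ln (\<integral>\<omega>. \<bar>u l x t \<omega>\<bar>\<^sup>2 \<partial>M) / l\<^sup>2))
        = ereal (L\<^sup>2 * (t - a) powr (2 * \<alpha> - 1) / (2 * \<alpha> - 1))))"
proof -
  interpret wiener_process M F W by (rule W)
  let ?rate = "\<lambda>x t l. ereal (ln (\<integral>\<omega>. \<bar>u l x t \<omega>\<bar>\<^sup>2 \<partial>M) / l\<^sup>2)"
  have "continuous_on UNIV \<sigma>"
  proof (rule lipschitz_on_continuous_on)
    show "Lip-lipschitz_on UNIV \<sigma>"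
      using \<sigma>_lipschitz Lip by (intro lipschitz_onI) (auto simp: dist_real_def)
  qed
  then have \<sigma>_meas: "\<sigma> \<in> borel_measurable borel"
    by (rule borel_measurable_continuous_onI)
  have \<sigma>_upper: "\<bar>\<sigma> y\<bar> \<le> Lip * \<bar>y\<bar>" for y
    using \<sigma>_lipschitz[of y 0] by (simp add: \<sigma>0)
  have bounds: "ereal (L\<^sup>2 * (t - a) powr (2 * \<alpha> - 1) / (2 * \<alpha> - 1)) \<le> Liminf at_top (?rate x t)"
    (is "ereal ?lo \<le> _")
    "Limsup at_top (?rate x t) \<le> ereal (Lip\<^sup>2 * (t - a) powr (2 * \<alpha> - 1) / (2 * \<alpha> - 1))"
    (is "_ \<le> ereal ?up")
    if t: "a < t" for x t
  proof -
    have p: "0 < (u0 x)\<^sup>2"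
      using u0_lower[of x] c by simp
    have lower: "(u0 x)\<^sup>2 * exp (l\<^sup>2 * ?lo) \<le> (\<integral>\<omega>. \<bar>u l x t \<omega>\<bar>\<^sup>2 \<partial>M)"
      and upper: "(\<integral>\<omega>. \<bar>u l x t \<omega>\<bar>\<^sup>2 \<partial>M) \<le> (u0 x)\<^sup>2 * exp (l\<^sup>2 * ?up)" if "0 < l" for l
      using second_moment_bounds[OF _ \<alpha>(1) that \<sigma>_meas \<sigma>_lower \<sigma>_upper _ _ solution[OF that]
          continuity[OF that], of t x] a L Lip t
      by (simp_all add: mult.assoc)
    have "\<forall>\<^sub>F l in at_top. ereal (ln ((u0 x)\<^sup>2 * exp (l\<^sup>2 * ?lo)) / l\<^sup>2) \<le> ?rate x t l"
      using eventually_gt_at_top[of 0]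
    proof eventually_elim
      case (elim l)
      have "ln ((u0 x)\<^sup>2 * exp (l\<^sup>2 * ?lo)) \<le> ln (\<integral>\<omega>. \<bar>u l x t \<omega>\<bar>\<^sup>2 \<partial>M)"
        using lower[OF elim] p by (intro ln_mono) auto
      then show ?case
        by (simp add: divide_right_mono)
    qed
    then have "Liminf at_top (\<lambda>l. ereal (ln ((u0 x)\<^sup>2 * exp (l\<^sup>2 * ?lo)) / l\<^sup>2))
        \<le> Liminf at_top (?rate x t)"
      by (rule Liminf_mono)
    then show "ereal ?lo \<le> Liminf at_top (?rate x t)"
      by (subst (asm) lim_imp_Liminf[OF _ log_exponential_rate_tendsto[OF p]]) simp_all
    have "\<forall>\<^sub>F l in at_top. ?rate x t l \<le> ereal (ln ((u0 x)\<^sup>2 * exp (l\<^sup>2 * ?up)) / l\<^sup>2)"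
      using eventually_gt_at_top[of 0]
    proof eventually_elim
      case (elim l)
      \<comment> \<open>The logarithm is monotone only on positive numbers; positivity comes from the lower bound.\<close>
      have "0 < (\<integral>\<omega>. \<bar>u l x t \<omega>\<bar>\<^sup>2 \<partial>M)"
        using lower[OF elim] p by (smt (verit) exp_gt_zero mult_pos_pos)
      then have "ln (\<integral>\<omega>. \<bar>u l x t \<omega>\<bar>\<^sup>2 \<partial>M) \<le> ln ((u0 x)\<^sup>2 * exp (l\<^sup>2 * ?up))"
        using upper[OF elim] by (intro ln_mono) auto
      then show ?case
        by (simp add: divide_right_mono)
    qed
    then have "Limsup at_top (?rate x t)
        \<le> Limsup at_top (\<lambda>l. ereal (ln ((u0 x)\<^sup>2 * exp (l\<^sup>2 * ?up)) / l\<^sup>2))"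
      by (rule Limsup_mono)
    then show "Limsup at_top (?rate x t) \<le> ereal ?up"
      by (subst (asm) lim_imp_Limsup[OF _ log_exponential_rate_tendsto[OF p]]) simp_all
  qed
  have Liminf_le: "Liminf at_top (?rate x t) \<le> Limsup at_top (?rate x t)" for x t
    by (rule Liminf_le_Limsup) simp
  show ?thesis
    using bounds Liminf_le order_trans[OF bounds(1) Liminf_le] by (auto intro!: antisym)
qed

end
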